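(* Let $K$ be a topological field, let $G$ be a countable discrete group, and let $V$ be a finite-dimensional $K$-linear representation of $G$. Then for every integer $p \geq 0$ the group of coboundaries $\mathcal{B}^p(G,V)$ is a closed subgroup of the group of cocycles $\mathcal{Z}^p(G,V)$.
   Context: A topological field is a field with a Hausdorff topology for which the field operations are continuous (the discrete topology is allowed). A finite-dimensional $K$-vector space $V$ carries the Hausdorff topology given by a linear identification with $K^{\dim V}$ (product topology). The representation is denoted $\pi: G \to \mathrm{GL}_K(V)$, $g\mapsto \pi^g$. For $p\geq 0$, $\mathcal{C}^p(G,V) := V^{G^p}$ is the group of all functions $G^p\to V$, with the product topology (so $\mathcal{C}^0(G,V)=V$). For $p\geq 1$ the coboundary operator $d_p:\mathcal{C}^{p-1}(G,V)\to\mathcal{C}^p(G,V)$ of the inhomogeneous bar resolution is $$d_pf(g_1,\ldots,g_p) := \pi^{g_1}f(g_2,\ldots,g_p) + \sum_{i=1}^{p-1}(-1)^i f(g_1,\ldots,g_ig_{i+1},\ldots,g_p) + (-1)^{p}f(g_1,\ldots,g_{p-1}),$$ and $d_0$ is interpreted as $0$. Set $\mathcal{Z}^p(G,V) := \ker d_{p+1}$ and $\mathcal{B}^p(G,V) := \mathrm{img}\, d_p$ (so $\mathcal{B}^0(G,V)=\{0\}$); $\mathcal{Z}^p(G,V)$ has the subspace topology from $\mathcal{C}^p(G,V)$. *)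

theory Defs
  imports "HOL-Algebra.Coset" "HOL-Analysis.Analysis"
begin

text \<open>Addition, negation and multiplication are continuous by the two superclasses.\<close>

class topological_field = field + t2_space + topological_group_add + topological_semigroup_mult +
  assumes tendsto_inverse_nhds: "a \<noteq> 0 \<Longrightarrow> (inverse \<longlongrightarrow> inverse a) (nhds a)"

text \<open>
  The topology on a vector space with finite basis \<open>B\<close> that makes the coordinate
  map to the product \<open>K\<^sup>B\<close> a homeomorphism.
\<close>

definition vector_topology ::
    "('k::topological_field \<Rightarrow> 'v::ab_group_add \<Rightarrow> 'v) \<Rightarrow> 'v set \<Rightarrow> 'v topology" where
  "vector_topology scl B =
     pullback_topology UNIV (\<lambda>v. \<lambda>b\<in>B. module.representation scl B v b)
       (product_topology (\<lambda>_. euclidean) B)"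

definition GL :: "('k::field \<Rightarrow> 'v::ab_group_add \<Rightarrow> 'v) \<Rightarrow> ('v \<Rightarrow> 'v) monoid" where
  "GL scl = \<lparr>carrier = {f. Vector_Spaces.linear scl scl f \<and> bij f}, monoid.mult = (\<circ>), one = id\<rparr>"

text \<open>
  Elements of \<open>G\<^sup>p\<close> are lists of length \<open>p\<close>; cochains are extensional functions
  on them.
\<close>

definition tuples :: "('g, 'm) monoid_scheme \<Rightarrow> nat \<Rightarrow> 'g list set" where
  "tuples G p = {gs. length gs = p \<and> set gs \<subseteq> carrier G}"

definition cochain_group ::
    "('g, 'm) monoid_scheme \<Rightarrow> nat \<Rightarrow> ('g list \<Rightarrow> 'v::ab_group_add) monoid" where
  "cochain_group G p =
     \<lparr>carrier = tuples G p \<rightarrow>\<^sub>E UNIV,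
      monoid.mult = (\<lambda>f h. \<lambda>gs\<in>tuples G p. f gs + h gs),
      one = (\<lambda>gs\<in>tuples G p. 0)\<rparr>"

definition cochain_topology ::
    "('g, 'm) monoid_scheme \<Rightarrow> 'v topology \<Rightarrow> nat \<Rightarrow> ('g list \<Rightarrow> 'v) topology" where
  "cochain_topology G T p = product_topology (\<lambda>_. T) (tuples G p)"

text \<open>
  \<open>coboundary scl G \<pi> p\<close> is the operator \<open>d\<^sub>p\<close> from cochains of degree \<open>p - 1\<close> to
  those of degree \<open>p\<close>, meaningful for \<open>p \<ge> 1\<close> only.  List positions start at 0,
  so \<open>g\<^sub>i\<close> is \<open>gs ! (i - 1)\<close>.
\<close>

definition coboundary ::
    "('k::field \<Rightarrow> 'v::ab_group_add \<Rightarrow> 'v) \<Rightarrow> ('g, 'm) monoid_scheme \<Rightarrow> ('g \<Rightarrow> 'v \<Rightarrow> 'v)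
      \<Rightarrow> nat \<Rightarrow> ('g list \<Rightarrow> 'v) \<Rightarrow> ('g list \<Rightarrow> 'v)" where
  "coboundary scl G \<pi> p f =
     (\<lambda>gs\<in>tuples G p.
        \<pi> (hd gs) (f (tl gs))
        + (\<Sum>i = 1..<p. scl ((- 1) ^ i)
             (f (take (i - 1) gs @ [gs ! (i - 1) \<otimes>\<^bsub>G\<^esub> gs ! i] @ drop (i + 1) gs)))
        + scl ((- 1) ^ p) (f (butlast gs)))"

definition cocycles ::
    "('k::field \<Rightarrow> 'v::ab_group_add \<Rightarrow> 'v) \<Rightarrow> ('g, 'm) monoid_scheme \<Rightarrow> ('g \<Rightarrow> 'v \<Rightarrow> 'v)
      \<Rightarrow> nat \<Rightarrow> ('g list \<Rightarrow> 'v) set" where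
  "cocycles scl G \<pi> p =
     {f \<in> carrier (cochain_group G p).
        coboundary scl G \<pi> (Suc p) f = \<one>\<^bsub>cochain_group G (Suc p)\<^esub>}"

primrec coboundaries ::
    "('k::field \<Rightarrow> 'v::ab_group_add \<Rightarrow> 'v) \<Rightarrow> ('g, 'm) monoid_scheme \<Rightarrow> ('g \<Rightarrow> 'v \<Rightarrow> 'v)
      \<Rightarrow> nat \<Rightarrow> ('g list \<Rightarrow> 'v) set" where
  "coboundaries scl G \<pi> 0 = {\<one>\<^bsub>cochain_group G 0\<^esub>}"
| "coboundaries scl G \<pi> (Suc p) =
     coboundary scl G \<pi> (Suc p) ` carrier (cochain_group G p)"

definition cocycle_group ::
    "('k::field \<Rightarrow> 'v::ab_group_add \<Rightarrow> 'v) \<Rightarrow> ('g, 'm) monoid_scheme \<Rightarrow> ('g \<Rightarrow> 'v \<Rightarrow> 'v)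
      \<Rightarrow> nat \<Rightarrow> ('g list \<Rightarrow> 'v) monoid" where
  "cocycle_group scl G \<pi> p = (cochain_group G p)\<lparr>carrier := cocycles scl G \<pi> p\<rparr>"

definition cocycle_topology ::
    "('k::field \<Rightarrow> 'v::ab_group_add \<Rightarrow> 'v) \<Rightarrow> ('g, 'm) monoid_scheme \<Rightarrow> ('g \<Rightarrow> 'v \<Rightarrow> 'v)
      \<Rightarrow> 'v topology \<Rightarrow> nat \<Rightarrow> ('g list \<Rightarrow> 'v) topology" where
  "cocycle_topology scl G \<pi> T p =
     subtopology (cochain_topology G T p) (cocycles scl G \<pi> p)"

lemma comm_group_cochain_group:
  "comm_group (cochain_group G p :: ('g list \<Rightarrow> 'v::ab_group_add) monoid)"
proof (rule comm_groupI)
  fix f :: "'g list \<Rightarrow> 'v"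
  assume "f \<in> carrier (cochain_group G p)"
  then show "\<exists>h\<in>carrier (cochain_group G p). h \<otimes>\<^bsub>cochain_group G p\<^esub> f = \<one>\<^bsub>cochain_group G p\<^esub>"
    by (intro bexI[of _ "\<lambda>gs\<in>tuples G p. - f gs"]) (auto simp: cochain_group_def)
qed (simp_all add: cochain_group_def restrict_def fun_eq_iff algebra_simps PiE_iff extensional_def)

lemma coboundary_mult:
  fixes G :: "('g, 'm) monoid_scheme" and scl :: "'k::field \<Rightarrow> 'v::ab_group_add \<Rightarrow> 'v"
  assumes "vector_space scl" "\<pi> \<in> hom G (GL scl)"
    and f: "f \<in> carrier (cochain_group G p)" and h: "h \<in> carrier (cochain_group G p)"
    and "group G"
  shows "coboundary scl G \<pi> (Suc p) (f \<otimes>\<^bsub>cochain_group G p\<^esub> h)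
    = coboundary scl G \<pi> (Suc p) f \<otimes>\<^bsub>cochain_group G (Suc p)\<^esub> coboundary scl G \<pi> (Suc p) h"
proof -
  interpret vector_space scl by fact
  interpret group G by fact
  let ?m = "\<lambda>gs i. take (i - Suc 0) gs @ gs ! (i - Suc 0) \<otimes>\<^bsub>G\<^esub> gs ! i # drop (Suc i) gs"
  have 1: "\<pi> g (x + y) = \<pi> g x + \<pi> g y" if "g \<in> carrier G" for g x y
  proof -
    have "\<pi> g \<in> carrier (GL scl)"
      using assms(2) that by (auto simp: hom_def)
    then interpret Vector_Spaces.linear scl scl "\<pi> g"
      by (simp add: GL_def)
    show ?thesis by (rule add)
  qed
  have 2: "hd gs \<in> carrier G" "tl gs \<in> tuples G p" "butlast gs \<in> tuples G p"
    if "gs \<in> tuples G (Suc p)" for gs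
    using that by (cases gs; auto simp: tuples_def dest: in_set_butlastD)+
  have 3: "?m gs i \<in> tuples G p"
    if "gs \<in> tuples G (Suc p)" "i \<in> {Suc 0..<Suc p}" for gs i
  proof -
    have "set (take (i - Suc 0) gs) \<subseteq> carrier G" "set (drop (Suc i) gs) \<subseteq> carrier G"
      using that(1) set_take_subset[of _ gs] set_drop_subset[of _ gs] unfolding tuples_def by blast+
    moreover have "gs ! (i - Suc 0) \<in> carrier G" "gs ! i \<in> carrier G"
      using that nth_mem[of i gs] nth_mem[of "i - Suc 0" gs] by (auto simp: tuples_def)
    ultimately show ?thesis
      using that by (auto simp: tuples_def)
  qed
  have mult: "(f \<otimes>\<^bsub>cochain_group G q\<^esub> h) gs = f gs + h gs" if "gs \<in> tuples G q"
    for q gs and f h :: "'g list \<Rightarrow> 'v"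
    using that by (simp add: cochain_group_def)
  show ?thesis
  proof
    fix gs
    show "coboundary scl G \<pi> (Suc p) (f \<otimes>\<^bsub>cochain_group G p\<^esub> h) gs =
      (coboundary scl G \<pi> (Suc p) f \<otimes>\<^bsub>cochain_group G (Suc p)\<^esub> coboundary scl G \<pi> (Suc p) h) gs"
    proof (cases "gs \<in> tuples G (Suc p)")
      case True
      have "(\<Sum>i = 1..<Suc p. scl ((- 1) ^ i) ((f \<otimes>\<^bsub>cochain_group G p\<^esub> h) (?m gs i))) =
          (\<Sum>i = 1..<Suc p. scl ((- 1) ^ i) (f (?m gs i)))
          + (\<Sum>i = 1..<Suc p. scl ((- 1) ^ i) (h (?m gs i)))"
        unfolding sum.distrib[symmetric]
        by (rule sum.cong) (simp_all add: mult[OF 3[OF True]] scale_right_distrib)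
      then show ?thesis
        using True 2[OF True]
        by (simp add: coboundary_def mult 1 scale_right_distrib del: sum.op_ivl_Suc)
    next
      case False
      then show ?thesis by (simp add: coboundary_def cochain_group_def)
    qed
  qed
qed

lemma comm_group_cocycle_group:
  fixes G :: "('g, 'm) monoid_scheme" and scl :: "'k::field \<Rightarrow> 'v::ab_group_add \<Rightarrow> 'v"
  assumes "vector_space scl" "group G" "\<pi> \<in> hom G (GL scl)"
  shows "comm_group (cocycle_group scl G \<pi> p)"
proof -
  interpret C: comm_group "cochain_group G p :: ('g list \<Rightarrow> 'v) monoid"
    by (rule comm_group_cochain_group)
  interpret D: comm_group "cochain_group G (Suc p) :: ('g list \<Rightarrow> 'v) monoid"
    by (rule comm_group_cochain_group)
  interpret d: group_hom "cochain_group G p" "cochain_group G (Suc p)" "coboundary scl G \<pi> (Suc p)"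
    using coboundary_mult[OF assms(1,3) _ _ assms(2)]
    by unfold_locales (auto simp: hom_def, auto simp: cochain_group_def coboundary_def)
  have "cocycles scl G \<pi> p =
      Coset.kernel (cochain_group G p) (cochain_group G (Suc p)) (coboundary scl G \<pi> (Suc p))"
    by (simp add: cocycles_def Coset.kernel_def)
  then have "subgroup (cocycles scl G \<pi> p) (cochain_group G p)"
    by (simp add: d.subgroup_kernel)
  then have "group (cocycle_group scl G \<pi> p)"
    unfolding cocycle_group_def by (rule subgroup.subgroup_is_group) (rule C.is_group)
  then show ?thesis
    by (rule group.group_comm_groupI)
      (simp add: cocycle_group_def cocycles_def C.m_comm)
qed

end

theory Submission
  imports Defs "HOL-Library.Function_Algebras"
begin

text \<open>
  The system \<open>d\<^sub>p c = f\<close>, written in coordinates, has infinitely many equations and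
  unknowns, but each equation involves only finitely many unknowns. Such a system is
  solvable as soon as every linear relation between finitely many left-hand sides also
  holds for the right-hand sides. So the coboundaries are cut out by functionals that
  depend on finitely many coordinates of \<open>f\<close>; these are continuous, whatever the
  topology of the field, and their common kernel is closed.
\<close>

subsection \<open>Consistent linear systems\<close>

text \<open>A linear functional may be prescribed freely on a maximal independent subfamily of the
  \<open>r j\<close>. Any other \<open>r j\<close> is a finite combination of that subfamily, and
  consistency forces the value \<open>f j\<close> there. The index set \<open>J\<close> may be
  infinite and \<open>r\<close> need not be injective.\<close>

lemma (in vector_space) exists_linear_functional:
  fixes r :: "'j \<Rightarrow> 'b" and f :: "'j \<Rightarrow> 'a"
  assumes consistent: "\<And>A u. finite A \<Longrightarrow> A \<subseteq> J \<Longrightarrow> (\<Sum>j\<in>A. scale (u j) (r j)) = 0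
    \<Longrightarrow> (\<Sum>j\<in>A. u j * f j) = 0"
  shows "\<exists>h. Vector_Spaces.linear scale (*) h \<and> (\<forall>j\<in>J. h (r j) = f j)"
proof -
  interpret pair: vector_space_pair scale "(*) :: 'a \<Rightarrow> 'a \<Rightarrow> 'a"
    by unfold_locales (simp_all add: algebra_simps)
  obtain C where C: "C \<subseteq> r ` J" "independent C" "r ` J \<subseteq> span C"
    by (rule maximal_independent_subset)
  \<comment> \<open>Several indices may carry the same vector; \<open>s\<close> picks one index for
    each basis vector in \<open>C\<close>.\<close>
  define s where "s = inv_into J r"
  have s: "s b \<in> J" "r (s b) = b" if "b \<in> C" for b
    using C(1) that by (auto simp: s_def inv_into_into f_inv_into_f)
  obtain h where h: "Vector_Spaces.linear scale (*) h" "\<And>b. b \<in> C \<Longrightarrow> h b = f (s b)"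
    using pair.linear_independent_extend[OF C(2), of "\<lambda>b. f (s b)"] by blast
  interpret h: Vector_Spaces.linear scale "(*)" h by fact
  have "h (r j) = f j" if j: "j \<in> J" for j
  proof (cases "j \<in> s ` C")
    case True
    then show ?thesis using s(2) h(2) by auto
  next
    case False
    have "r j \<in> span C" using C(3) j by blast
    then obtain t a where t: "finite t" "t \<subseteq> C" "r j = (\<Sum>b\<in>t. scale (a b) b)"
      by (auto simp: span_explicit)
    have inj: "inj_on s t"
      using s(2) t(2) by (metis inj_onI subsetD)
    \<comment> \<open>These are the coefficients of the relation expressing \<open>r j\<close>
      through \<open>C\<close>, carried from vectors to indices: \<open>r\<close> undoes
      \<open>s\<close>, so \<open>s b\<close> receives \<open>a b\<close>. As \<open>j\<close> was
      not chosen by \<open>s\<close>, its coefficient \<open>- 1\<close> collides with none of the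
      others, even if \<open>r j\<close> lies in \<open>C\<close>.\<close>
    let ?u = "\<lambda>i. if i = j then - 1 else a (r i)"
    have jt: "j \<notin> s ` t" using False t(2) by blast
    have ne: "\<And>b. b \<in> t \<Longrightarrow> s b \<noteq> j" using jt by auto
    have rs: "\<And>b. b \<in> t \<Longrightarrow> r (s b) = b" using s(2) t(2) by blast
    have "(\<Sum>i\<in>insert j (s ` t). scale (?u i) (r i)) = - r j + (\<Sum>b\<in>t. scale (a b) b)"
      using t(1) jt by (simp add: sum.reindex[OF inj] ne rs)
    then have "(\<Sum>i\<in>insert j (s ` t). ?u i * f i) = 0"
      using j t s(1) by (intro consistent) auto
    moreover have "(\<Sum>i\<in>insert j (s ` t). ?u i * f i) = - f j + (\<Sum>b\<in>t. a b * f (s b))"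
      using t(1) jt by (simp add: sum.reindex[OF inj] ne rs)
    moreover have "h (r j) = (\<Sum>b\<in>t. a b * f (s b))"
      using t(2) by (auto simp: t(3) h.sum h.scale h(2) intro!: sum.cong)
    ultimately show ?thesis by (simp add: eq_neg_iff_add_eq_0)
  qed
  with h(1) show ?thesis by blast
qed

subsection \<open>Face operators\<close>

text \<open>Recursion replaces the \<open>take\<close>/\<open>drop\<close> expression in
  \<open>coboundary\<close>, so that the identity for two successive merges can be proved by
  stripping a common prefix. Lists that are too short are left unchanged.\<close>

fun merge_at :: "('g, 'm) monoid_scheme \<Rightarrow> nat \<Rightarrow> 'g list \<Rightarrow> 'g list" where
  "merge_at G 0 (a # b # gs) = (a \<otimes>\<^bsub>G\<^esub> b) # gs"
| "merge_at G (Suc i) (a # gs) = a # merge_at G i gs"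
| "merge_at G i gs = gs"

lemma merge_at_eq:
  "Suc i < length gs \<Longrightarrow>
    merge_at G i gs = take i gs @ [gs ! i \<otimes>\<^bsub>G\<^esub> gs ! Suc i] @ drop (Suc (Suc i)) gs"
  by (induction G i gs rule: merge_at.induct) auto

lemma length_merge_at: "Suc i < length gs \<Longrightarrow> length (merge_at G i gs) = length gs - 1"
  by (simp add: merge_at_eq)

lemma (in monoid) set_merge_at: "set gs \<subseteq> carrier G \<Longrightarrow> set (merge_at G i gs) \<subseteq> carrier G"
proof (induction i arbitrary: gs)
  case 0
  then show ?case by (cases gs; cases "tl gs") auto
next
  case (Suc i)
  then show ?case by (cases gs) auto
qed

lemma butlast_merge_at:
  "Suc (Suc i) < length gs \<Longrightarrow> butlast (merge_at G i gs) = merge_at G i (butlast gs)"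
  by (simp add: merge_at_eq butlast_append butlast_take nth_butlast take_butlast drop_butlast)

lemma butlast_merge_at_last:
  "Suc (Suc i) = length gs \<Longrightarrow> butlast (merge_at G i gs) = butlast (butlast gs)"
  by (drule sym) (simp add: merge_at_eq butlast_append butlast_conv_take)

text \<open>Induction on \<open>i\<close> reduces to a merge at the head. For
  \<open>j = i + 1\<close> both sides multiply the same three entries and the identity is
  associativity; for larger \<open>j\<close> the merges are disjoint, and the earlier one shifts the
  later position by one.\<close>

lemma (in monoid) merge_at_merge_at:
  assumes "i < j" "Suc j < length gs" "set gs \<subseteq> carrier G"
  shows "merge_at G i (merge_at G j gs) = merge_at G (j - 1) (merge_at G i gs)"
  using assms
proof (induction i arbitrary: j gs)
  case 0
  then obtain k a b gs' where "j = Suc k" "gs = a # b # gs'"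
    by (cases j; cases gs; cases "tl gs") auto
  with 0 show ?case by (cases k; cases gs') (auto simp: m_assoc)
next
  case (Suc i)
  then obtain k a gs' where "j = Suc k" "gs = a # gs'" "i < k"
    by (cases j; cases gs) auto
  with Suc show ?case by (cases k) auto
qed

text \<open>These are the cofaces whose alternating sum is the bar differential. The degree is read
  off from \<open>length gs\<close>, so one definition serves all degrees; \<open>i\<close> counts
  from 1 for the merges, hence \<open>i - 1\<close>.\<close>

definition face ::
    "('g, 'm) monoid_scheme \<Rightarrow> ('g \<Rightarrow> 'v \<Rightarrow> 'v) \<Rightarrow> nat \<Rightarrow> ('g list \<Rightarrow> 'v) \<Rightarrow> 'g list \<Rightarrow> 'v" where
  "face G \<pi> i f gs =
     (if i = 0 then \<pi> (hd gs) (f (tl gs))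
      else if i < length gs then f (merge_at G (i - 1) gs)
      else f (butlast gs))"

text \<open>The terms with \<open>i < j\<close> are matched with those with \<open>j \<le> i\<close>
  by sending \<open>(j, i)\<close> to \<open>(i, j - 1)\<close>. Matched terms have equal values,
  and their exponents differ by one, so they cancel in every characteristic.\<close>

lemma (in vector_space) alternating_double_sum_eq_0:
  assumes "\<And>i j. i < j \<Longrightarrow> j \<le> Suc q \<Longrightarrow> a j i = a i (j - 1)"
  shows "(\<Sum>j\<le>Suc q. \<Sum>i\<le>q. scale ((- 1) ^ (i + j)) (a j i)) = 0"
proof -
  let ?t = "\<lambda>(j, i). scale ((- 1) ^ (i + j)) (a j i)"
  let ?S = "{..Suc q} \<times> {..q}"
  let ?U = "{x \<in> ?S. snd x < fst x}" and ?L = "{x \<in> ?S. fst x \<le> snd x}"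
  have "sum ?t ?U = sum (\<lambda>x. - ?t x) ?L"
  proof (rule sum.reindex_bij_witness[of _ "\<lambda>(j, i). (Suc i, j)" "\<lambda>(j, i). (i, j - 1)"])
    fix x assume "x \<in> ?U"
    then obtain k i where x: "x = (Suc k, i)" "i \<le> k" "k \<le> q"
      by (cases x; cases "fst x") auto
    with assms[of i "Suc k"] show "- ?t (case x of (j, i) \<Rightarrow> (i, j - 1)) = ?t x"
      by (simp add: add.commute)
  qed auto
  moreover have "sum ?t ?S = sum ?t ?U + sum ?t ?L"
    by (subst sum.union_disjoint[symmetric]) (auto intro!: arg_cong2[of _ _ _ _ sum])
  ultimately show ?thesis
    by (simp add: sum.cartesian_product sum_negf)
qed

section \<open>The bar complex of a linear representation, without topology\<close>

locale linear_representation = group G + vector_space scl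
  for G :: "('g, 'm) monoid_scheme" (structure)
    and scl :: "'k::field \<Rightarrow> 'v::ab_group_add \<Rightarrow> 'v" +
  fixes \<pi> :: "'g \<Rightarrow> 'v \<Rightarrow> 'v"
  assumes hom_GL: "\<pi> \<in> hom G (GL scl)"
begin

lemma linear_action: "g \<in> carrier G \<Longrightarrow> Vector_Spaces.linear scl scl (\<pi> g)"
  using hom_GL by (auto simp: hom_def GL_def)

lemma action_mult: "g \<in> carrier G \<Longrightarrow> h \<in> carrier G \<Longrightarrow> \<pi> (g \<otimes> h) v = \<pi> g (\<pi> h v)"
  using hom_GL by (auto simp: hom_def GL_def)

text \<open>This is the cosimplicial identity behind \<open>d d = 0\<close>. The outer face is the
  one that transforms \<open>gs\<close> first.\<close>

lemma face_face:
  assumes gs: "set gs \<subseteq> carrier G" "length gs = Suc q" "0 < q" and ij: "i < j" "j \<le> Suc q"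
  shows "face G \<pi> j (face G \<pi> i f) gs = face G \<pi> i (face G \<pi> (j - 1) f) gs"
proof -
  obtain a b hs where gs_eq: "gs = a # b # hs"
    using gs by (cases gs; cases "tl gs") auto
  obtain l where j: "j = Suc l" using ij(1) by (cases j) auto
  \<comment> \<open>With \<open>j = Suc l\<close>, the value \<open>l = q\<close> means that the
    face \<open>j\<close> drops the last entry. The first case is multiplicativity of the action and
    the third is \<open>merge_at_merge_at\<close>; in the last, the merged final entry is dropped
    anyway. The others are operations on disjoint parts of the list.\<close>
  consider "i = 0" "l = 0" | "i = 0" "0 < l" "l < q" | "0 < i" "i \<le> l" "l < q"
    | "i = 0" "l = q" | "0 < i" "i < q" "l = q" | "0 < i" "i = q" "l = q"
    using ij gs(3) j by atomize_elim presburger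
  then show ?thesis
  proof cases
    case 1
    then show ?thesis using gs gs_eq j by (simp add: face_def action_mult)
  next
    case 2
    then obtain k where "l = Suc k" by (cases l) auto
    with 2 show ?thesis using gs gs_eq j by (simp add: face_def)
  next
    case 3
    then show ?thesis
      using gs j merge_at_merge_at[of "i - 1" l gs] by (simp add: face_def length_merge_at)
  next
    case 4
    then show ?thesis using gs gs_eq j by (simp add: face_def)
  next
    case 5
    then show ?thesis using gs j by (simp add: face_def length_merge_at butlast_merge_at)
  next
    case 6
    then show ?thesis using gs j by (simp add: face_def length_merge_at butlast_merge_at_last)
  qed
qed

lemma tuples_face:
  assumes "gs \<in> tuples G (Suc p)"
  shows "hd gs \<in> carrier G" "tl gs \<in> tuples G p" "butlast gs \<in> tuples G p"
    "i < p \<Longrightarrow> merge_at G i gs \<in> tuples G p"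
  using assms set_merge_at[of gs i]
  by (cases gs; simp add: tuples_def length_merge_at; fastforce dest: in_set_butlastD)+

lemma coboundary_eq_faces:
  assumes gs: "gs \<in> tuples G (Suc p)"
  shows "coboundary scl G \<pi> (Suc p) f gs = (\<Sum>i\<le>Suc p. scl ((- 1) ^ i) (face G \<pi> i f gs))"
proof -
  have len: "length gs = Suc p" using gs by (simp add: tuples_def)
  have "(\<Sum>i\<le>Suc p. scl ((- 1) ^ i) (face G \<pi> i f gs)) =
      face G \<pi> 0 f gs + (\<Sum>i=1..<Suc p. scl ((- 1) ^ i) (face G \<pi> i f gs))
      + scl ((- 1) ^ Suc p) (face G \<pi> (Suc p) f gs)"
    using sum.atLeast_Suc_atMost[of 0 p "\<lambda>i. scl ((- 1) ^ i) (face G \<pi> i f gs)"]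
    by (simp add: atMost_atLeast0 atLeastLessThanSuc_atLeastAtMost del: sum.op_ivl_Suc)
  moreover have "(\<Sum>i=1..<Suc p. scl ((- 1) ^ i) (face G \<pi> i f gs)) =
      (\<Sum>i = 1..<Suc p. scl ((- 1) ^ i)
             (f (take (i - 1) gs @ [gs ! (i - 1) \<otimes>\<^bsub>G\<^esub> gs ! i] @ drop (i + 1) gs)))"
    using len by (intro sum.cong) (auto simp: face_def merge_at_eq)
  ultimately show ?thesis
    using gs len by (simp add: coboundary_def face_def del: sum.op_ivl_Suc)
qed

text \<open>A coboundary equals the alternating sum of faces on tuples only. This allows the
  rewriting below an outer face, which evaluates its argument only at tuples.\<close>

lemma face_cong:
  assumes "gs \<in> tuples G (Suc p)" "i \<le> Suc p" "\<And>hs. hs \<in> tuples G p \<Longrightarrow> f hs = f' hs"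
  shows "face G \<pi> i f gs = face G \<pi> i f' gs"
  using assms tuples_face[OF assms(1)] by (auto simp: face_def tuples_def[of G "Suc p"])

lemma face_sum:
  assumes "gs \<in> tuples G (Suc p)"
  shows "face G \<pi> j (\<lambda>hs. \<Sum>i\<in>I. scl (a i) (f i hs)) gs = (\<Sum>i\<in>I. scl (a i) (face G \<pi> j (f i) gs))"
proof -
  interpret L: Vector_Spaces.linear scl scl "\<pi> (hd gs)"
    by (rule linear_action) (rule tuples_face(1)[OF assms])
  show ?thesis by (simp add: face_def L.sum L.scale)
qed

lemma coboundary_coboundary:
  assumes gs: "gs \<in> tuples G (Suc (Suc p))"
  shows "coboundary scl G \<pi> (Suc (Suc p)) (coboundary scl G \<pi> (Suc p) f) gs = 0"
proof -
  let ?a = "\<lambda>j i. face G \<pi> j (face G \<pi> i f) gs"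
  have "coboundary scl G \<pi> (Suc (Suc p)) (coboundary scl G \<pi> (Suc p) f) gs =
      (\<Sum>j\<le>Suc (Suc p). scl ((- 1) ^ j) (face G \<pi> j (coboundary scl G \<pi> (Suc p) f) gs))"
    by (rule coboundary_eq_faces[OF gs])
  also have "\<dots> = (\<Sum>j\<le>Suc (Suc p). scl ((- 1) ^ j)
      (face G \<pi> j (\<lambda>hs. \<Sum>i\<le>Suc p. scl ((- 1) ^ i) (face G \<pi> i f hs)) gs))"
    by (intro sum.cong arg_cong2[of _ _ _ _ scl] face_cong[OF gs] coboundary_eq_faces) auto
  also have "\<dots> = (\<Sum>j\<le>Suc (Suc p). \<Sum>i\<le>Suc p. scl ((- 1) ^ (i + j)) (?a j i))"
    unfolding face_sum[OF gs] scale_sum_right by (simp add: power_add mult.commute)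
  also have "\<dots> = 0"
    using gs by (intro alternating_double_sum_eq_0 face_face[where q = "Suc p"]) (auto simp: tuples_def)
  finally show ?thesis .
qed

lemma coboundaries_subset_cocycles: "coboundaries scl G \<pi> p \<subseteq> cocycles scl G \<pi> p"
proof (cases p)
  case 0
  \<comment> \<open>In degree 0 the coboundaries are \<open>{0}\<close> by convention and not an
    image, so \<open>d d = 0\<close> does not apply; the zero cochain is a cocycle because the
    action fixes 0.\<close>
  have "\<pi> g 0 = 0" if "g \<in> carrier G" for g
  proof -
    interpret L: Vector_Spaces.linear scl scl "\<pi> g" by (rule linear_action[OF that])
    show ?thesis by (rule L.zero)
  qed
  then show ?thesis
    using 0 by (auto simp: cocycles_def cochain_group_def coboundary_def fun_eq_iff tuples_def length_Suc_conv)
next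
  case (Suc q)
  have "coboundary scl G \<pi> (Suc q) f \<in> cocycles scl G \<pi> (Suc q)" for f
    using coboundary_coboundary[of _ q f]
    by (auto simp: cocycles_def cochain_group_def coboundary_def[of _ _ _ "Suc (Suc q)"] fun_eq_iff)
      (auto simp: coboundary_def)
  then show ?thesis using Suc by auto
qed

lemma subgroup_coboundaries: "subgroup (coboundaries scl G \<pi> p) (cocycle_group scl G \<pi> p)"
proof (cases p)
  case 0
  have grp: "group (cocycle_group scl G \<pi> 0)"
    using comm_group_cocycle_group[OF vector_space_axioms is_group hom_GL]
    by (rule comm_group.axioms)
  have "\<one>\<^bsub>cochain_group G 0\<^esub> = \<one>\<^bsub>cocycle_group scl G \<pi> 0\<^esub>"
    by (simp add: cocycle_group_def)
  then show ?thesis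
    using 0 group.triv_subgroup[OF grp] by simp
next
  case (Suc q)
  let ?C = "\<lambda>p. cochain_group G p :: ('g list \<Rightarrow> 'v) monoid"
  interpret C: comm_group "?C q" by (rule comm_group_cochain_group)
  interpret D: comm_group "?C p" by (rule comm_group_cochain_group)
  interpret d: group_hom "?C q" "?C p" "coboundary scl G \<pi> p"
    using coboundary_mult[OF vector_space_axioms hom_GL _ _ is_group] Suc
    by unfold_locales (auto simp: hom_def, auto simp: cochain_group_def coboundary_def)
  have "subgroup (coboundaries scl G \<pi> p) (?C p)"
    using d.img_is_subgroup Suc by simp
  moreover have "subgroup (cocycles scl G \<pi> p) (?C p)"
  proof -
    interpret E: comm_group "?C (Suc p)" by (rule comm_group_cochain_group)
    interpret e: group_hom "?C p" "?C (Suc p)" "coboundary scl G \<pi> (Suc p)"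
      using coboundary_mult[OF vector_space_axioms hom_GL _ _ is_group]
      by unfold_locales (auto simp: hom_def, auto simp: cochain_group_def coboundary_def)
    show ?thesis
      using e.subgroup_kernel by (simp add: cocycles_def Coset.kernel_def)
  qed
  ultimately show ?thesis
    unfolding cocycle_group_def
    by (intro D.subgroup_incl coboundaries_subset_cocycles)
qed

end

subsection \<open>Coboundaries as a common kernel\<close>

lemma sum_apply: "(\<Sum>i\<in>I. f i) x = (\<Sum>i\<in>I. f i x)"
  by (induction I rule: infinite_finite_induct) auto

locale finite_dimensional_representation =
  linear_representation G scl \<pi> + finite_dimensional_vector_space scl B
  for G :: "('g, 'm) monoid_scheme" (structure)
    and scl :: "'k::field \<Rightarrow> 'v::ab_group_add \<Rightarrow> 'v"
    and \<pi> :: "'g \<Rightarrow> 'v \<Rightarrow> 'v"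
    and B :: "'v set"
begin

lemma sum_representation: "(\<Sum>b\<in>B. scl (representation B v b) b) = v"
  by (simp add: sum_representation_eq independent_Basis span_Basis finite_Basis)

lemma representation_simps:
  "representation B (u + v) b = representation B u b + representation B v b"
  "representation B (scl a v) b = a * representation B v b"
  "representation B (sum w I) b = (\<Sum>i\<in>I. representation B (w i) b)"
  by (simp_all add: representation_add representation_scale representation_sum
    independent_Basis span_Basis)

text \<open>The matrix of \<open>\<pi> g\<close> shows that each coordinate of
  \<open>\<pi> g v\<close> involves only finitely many coordinates of \<open>v\<close>.\<close>

lemma representation_action:
  assumes "g \<in> carrier G"
  shows "representation B (\<pi> g v) b =
    (\<Sum>b'\<in>B. representation B (\<pi> g b') b * representation B v b')"
proof -
  interpret L: Vector_Spaces.linear scl scl "\<pi> g" by (rule linear_action[OF assms])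
  have "\<pi> g v = \<pi> g (\<Sum>b'\<in>B. scl (representation B v b') b')"
    by (simp only: sum_representation)
  also have "\<dots> = (\<Sum>b'\<in>B. scl (representation B v b') (\<pi> g b'))"
    by (simp only: L.sum L.scale)
  finally show ?thesis
    by (simp only: representation_simps mult.commute)
qed

text \<open>A tuple and a basis vector together index one scalar of a cochain. Such scalars are the
  unknowns in degree \<open>p\<close> and the right-hand sides in degree
  \<open>Suc p\<close>.\<close>

definition coordinate :: "'g list \<times> 'v \<Rightarrow> ('g list \<Rightarrow> 'v) \<Rightarrow> 'k" where
  "coordinate j f = representation B (f (fst j)) (snd j)"

lemma coboundary_if_annihilated:
  fixes f :: "'g list \<Rightarrow> 'v" and p :: nat
  defines "J \<equiv> tuples G (Suc p) \<times> B"
  assumes f: "f \<in> carrier (cochain_group G (Suc p))"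
    and ann: "\<And>A u. finite A \<Longrightarrow> A \<subseteq> J
      \<Longrightarrow> (\<And>c. (\<Sum>j\<in>A. u j * coordinate j (coboundary scl G \<pi> (Suc p) c)) = 0)
      \<Longrightarrow> (\<Sum>j\<in>A. u j * coordinate j f) = 0"
  shows "f \<in> coboundaries scl G \<pi> (Suc p)"
proof -
  \<comment> \<open>The right-hand sides extend to a linear functional \<open>h\<close> on the space of all functions
    of a cochain, and the values of \<open>h\<close> at the coordinate functions form a solution \<open>c\<close>:
    evaluation at \<open>c\<close> agrees with \<open>h\<close> on their span, which contains the left-hand sides.\<close>
  define scale_fun :: "'k \<Rightarrow> (('g list \<Rightarrow> 'v) \<Rightarrow> 'k) \<Rightarrow> ('g list \<Rightarrow> 'v) \<Rightarrow> 'k"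
    where "scale_fun = (\<lambda>a \<phi> c. a * \<phi> c)"
  interpret F: vector_space scale_fun
    by unfold_locales (auto simp: scale_fun_def algebra_simps fun_eq_iff)
  interpret pair: vector_space_pair scale_fun "(*) :: 'k \<Rightarrow> 'k \<Rightarrow> 'k"
    by unfold_locales (simp_all add: algebra_simps)
  \<comment> \<open>\<open>r j\<close> is the left-hand side of equation \<open>j\<close>, viewed as
    a vector in the space of functions of \<open>c\<close>. A linear relation among these vectors
    thus means vanishing at every \<open>c\<close>, which is the premise of
    \<open>ann\<close>.\<close>
  define r where "r = (\<lambda>j c. coordinate j (coboundary scl G \<pi> (Suc p) c))"
  have "\<exists>h. Vector_Spaces.linear scale_fun (*) h \<and> (\<forall>j\<in>J. h (r j) = coordinate j f)"
  proof (rule F.exists_linear_functional)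
    fix A and u :: "'g list \<times> 'v \<Rightarrow> 'k"
    assume A: "finite A" "A \<subseteq> J" and "(\<Sum>j\<in>A. scale_fun (u j) (r j)) = 0"
    then have "(\<Sum>j\<in>A. u j * r j c) = 0" for c
      by (auto simp: scale_fun_def sum_apply dest!: fun_cong[of _ _ c])
    then show "(\<Sum>j\<in>A. u j * coordinate j f) = 0"
      using ann[OF A] by (simp add: r_def)
  qed
  then obtain h where h: "Vector_Spaces.linear scale_fun (*) h"
    and hr: "\<And>j. j \<in> J \<Longrightarrow> h (r j) = coordinate j f" by blast
  define c where "c = (\<lambda>hs\<in>tuples G p. \<Sum>b\<in>B. scl (h (coordinate (hs, b))) b)"
  define E where "E = coordinate ` (tuples G p \<times> B)"
  \<comment> \<open>The coordinates of a basis vector are Kronecker deltas, so only the summand for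
    \<open>b\<close> survives.\<close>
  have c_E: "\<phi> c = h \<phi>" if \<phi>: "\<phi> \<in> E" for \<phi>
  proof -
    obtain hs b where hs: "hs \<in> tuples G p" "b \<in> B" "\<phi> = coordinate (hs, b)"
      using \<phi> by (auto simp: E_def)
    have "\<phi> c = (\<Sum>b'\<in>B. h (coordinate (hs, b')) * representation B b' b)"
      using hs by (simp add: coordinate_def[of "(hs, b)"] c_def representation_simps)
    also have "\<dots> = (\<Sum>b'\<in>B. if b' = b then h (coordinate (hs, b')) else 0)"
      by (intro sum.cong) (auto simp: representation_basis independent_Basis)
    also have "\<dots> = h \<phi>" using hs finite_Basis by simp
    finally show ?thesis .
  qed
  have lin_eval: "Vector_Spaces.linear scale_fun (*) (\<lambda>\<phi>. \<phi> c)"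
    by unfold_locales (simp_all add: scale_fun_def algebra_simps)
  \<comment> \<open>Each equation involves finitely many unknowns: face 0 contributes a row of the
    matrix of \<open>\<pi> (hd gs)\<close>, every other face a single coordinate.\<close>
  have face_span: "(\<lambda>c. representation B (face G \<pi> i c gs) b) \<in> F.span E"
    if gs: "gs \<in> tuples G (Suc p)" and b: "b \<in> B" and i: "i \<le> Suc p" for gs b i
  proof (cases "i = 0")
    case True
    have "(\<lambda>c. representation B (face G \<pi> i c gs) b) =
        (\<Sum>b'\<in>B. scale_fun (representation B (\<pi> (hd gs) b') b) (coordinate (tl gs, b')))"
      using True tuples_face(1)[OF gs]
      by (auto simp: face_def sum_apply scale_fun_def coordinate_def representation_action[of "hd gs" _ b])
    also have "\<dots> \<in> F.span E"
      using tuples_face(2)[OF gs] by (intro F.span_sum F.span_scale F.span_base) (auto simp: E_def)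
    finally show ?thesis .
  next
    case False
    define hs where "hs = (if i < Suc p then merge_at G (i - 1) gs else butlast gs)"
    have "hs \<in> tuples G p" "\<And>c. face G \<pi> i c gs = c hs"
      using False gs i tuples_face(3,4)[OF gs] by (auto simp: hs_def face_def tuples_def[of G "Suc p"])
    then show ?thesis
      using b by (intro F.span_base) (auto simp: E_def coordinate_def intro!: image_eqI[of _ _ "(hs, b)"])
  qed
  have r_span: "r j \<in> F.span E" if jJ: "j \<in> J" for j
  proof -
    obtain gs b where j: "j = (gs, b)" "gs \<in> tuples G (Suc p)" "b \<in> B"
      using jJ by (auto simp: J_def)
    have "r j = (\<Sum>i\<le>Suc p. scale_fun ((- 1) ^ i) (\<lambda>c. representation B (face G \<pi> i c gs) b))"
      using j by (simp add: r_def coordinate_def coboundary_eq_faces representation_simps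
        scale_fun_def fun_eq_iff sum_apply del: sum.atMost_Suc)
    also have "\<dots> \<in> F.span E"
      using j by (intro F.span_sum F.span_scale face_span) auto
    finally show ?thesis .
  qed
  have eq: "coordinate j (coboundary scl G \<pi> (Suc p) c) = coordinate j f" if "j \<in> J" for j
    using pair.linear_eq_on[OF lin_eval h r_span[OF that] c_E] hr[OF that] by (simp add: r_def)
  have "coboundary scl G \<pi> (Suc p) c gs = f gs" if gs: "gs \<in> tuples G (Suc p)" for gs
  proof -
    have "(\<Sum>b\<in>B. scl (representation B (coboundary scl G \<pi> (Suc p) c gs) b) b) =
        (\<Sum>b\<in>B. scl (representation B (f gs) b) b)"
    proof (rule sum.cong)
      fix b assume "b \<in> B"
      then show "scl (representation B (coboundary scl G \<pi> (Suc p) c gs) b) b =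
          scl (representation B (f gs) b) b"
        using gs eq[of "(gs, b)"] by (simp add: J_def coordinate_def)
    qed simp
    then show ?thesis by (simp only: sum_representation)
  qed
  moreover have "coboundary scl G \<pi> (Suc p) c gs = f gs" if "gs \<notin> tuples G (Suc p)" for gs
    using f that by (auto simp: cochain_group_def coboundary_def)
  ultimately have "f = coboundary scl G \<pi> (Suc p) c"
    by (intro ext) metis
  moreover have "c \<in> carrier (cochain_group G p)"
    by (simp add: c_def cochain_group_def)
  ultimately show ?thesis by simp
qed

end

section \<open>Closedness in the product topology\<close>

lemma topspace_cochain_topology:
  "topspace (cochain_topology G (vector_topology scl B) p) = carrier (cochain_group G p)"
  by (simp add: cochain_topology_def vector_topology_def cochain_group_def
    topspace_pullback_topology vimage_def restrict_PiE_iff)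

text \<open>Each functional is a finite combination of coordinates, hence continuous, and its kernel
  is the preimage of the closed set \<open>{0}\<close> of a Hausdorff field. The set of functionals
  may be arbitrarily large.\<close>

lemma closedin_common_kernel:
  fixes scl :: "'k::topological_field \<Rightarrow> 'v::ab_group_add \<Rightarrow> 'v"
  assumes "\<And>A u. (A, u) \<in> \<Lambda> \<Longrightarrow> finite A \<and> A \<subseteq> tuples G p \<times> B"
  shows "closedin (cochain_topology G (vector_topology scl B) p)
    {f \<in> carrier (cochain_group G p).
      \<forall>(A, u)\<in>\<Lambda>. (\<Sum>j\<in>A. u j * module.representation scl B (f (fst j)) (snd j)) = 0}"
proof -
  let ?X = "cochain_topology G (vector_topology scl B) p"
  let ?c = "\<lambda>j f. module.representation scl B (f (fst j)) (snd j)"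
  have coord: "continuous_map ?X euclidean (?c j)" if "j \<in> tuples G p \<times> B" for j
  proof -
    have "continuous_map ?X (vector_topology scl B) (\<lambda>f. f (fst j))"
      unfolding cochain_topology_def using that by (intro continuous_map_product_projection) auto
    moreover have "continuous_map (vector_topology scl B) (product_topology (\<lambda>_. euclidean) B)
        (\<lambda>v. \<lambda>b\<in>B. module.representation scl B v b)"
      using continuous_map_pullback[OF continuous_map_id, of UNIV "\<lambda>v. \<lambda>b\<in>B. module.representation scl B v b"
          "product_topology (\<lambda>_. euclidean) B"]
      by (simp add: vector_topology_def)
    moreover have "continuous_map (product_topology (\<lambda>_. euclidean) B)
        (euclidean :: 'k topology) (\<lambda>x. x (snd j))"
      using that by (intro continuous_map_product_projection) auto
    ultimately have "continuous_map ?X euclidean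
        ((\<lambda>x. x (snd j)) \<circ> (\<lambda>v. \<lambda>b\<in>B. module.representation scl B v b) \<circ> (\<lambda>f. f (fst j)))"
      by (intro continuous_map_compose)
    then show ?thesis using that by (auto simp: o_def)
  qed
  have functional: "continuous_map ?X euclidean (\<lambda>f. \<Sum>j\<in>A. u j * ?c j f)"
    if "finite A" "A \<subseteq> tuples G p \<times> B" for A u
    using that
  proof (induction A rule: finite_induct)
    case (insert j A)
    then show ?case
      using coord[of j] by (auto simp: continuous_map_atin intro!: tendsto_add tendsto_mult_left)
  qed simp
  have "closedin ?X {f \<in> topspace ?X. (\<Sum>j\<in>A. u j * ?c j f) \<in> {0}}" if "(A, u) \<in> \<Lambda>" for A u
    using functional assms[OF that] by (intro closedin_continuous_map_preimage) auto
  \<comment> \<open>Inserting the whole space keeps the family nonempty when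
    \<open>\<Lambda>\<close> is empty.\<close>
  then have "closedin ?X (\<Inter>(insert (topspace ?X)
      ((\<lambda>(A, u). {f \<in> topspace ?X. (\<Sum>j\<in>A. u j * ?c j f) \<in> {0}}) ` \<Lambda>)))"
    by (intro closedin_Inter) auto
  also have "\<Inter>(insert (topspace ?X)
      ((\<lambda>(A, u). {f \<in> topspace ?X. (\<Sum>j\<in>A. u j * ?c j f) \<in> {0}}) ` \<Lambda>)) =
    {f \<in> carrier (cochain_group G p). \<forall>(A, u)\<in>\<Lambda>. (\<Sum>j\<in>A. u j * ?c j f) = 0}"
    by (auto simp: topspace_cochain_topology)
  finally show ?thesis .
qed

theorem theorem1:
  fixes G :: "('g, 'm) monoid_scheme"
    and scl :: "'k::topological_field \<Rightarrow> 'v::ab_group_add \<Rightarrow> 'v"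
    and B :: "'v set"
    and \<pi> :: "'g \<Rightarrow> 'v \<Rightarrow> 'v"
    and p :: nat
  assumes "group G"
    and "countable (carrier G)"
    and "finite_dimensional_vector_space scl B"
    and "\<pi> \<in> hom G (GL scl)"
  shows "subgroup (coboundaries scl G \<pi> p) (cocycle_group scl G \<pi> p) \<and>
    closedin (cocycle_topology scl G \<pi> (vector_topology scl B) p) (coboundaries scl G \<pi> p)"
proof -
  interpret finite_dimensional_vector_space scl B by fact
  interpret group G by fact
  interpret finite_dimensional_representation G scl \<pi> B
    by unfold_locales fact
  have "\<exists>\<Lambda>. (\<forall>A u. (A, u) \<in> \<Lambda> \<longrightarrow> finite A \<and> A \<subseteq> tuples G p \<times> B) \<and>
    coboundaries scl G \<pi> p = {f \<in> carrier (cochain_group G p).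
      \<forall>(A, u)\<in>\<Lambda>. (\<Sum>j\<in>A. u j * coordinate j f) = 0}"
  proof (cases p)
    case 0
    \<comment> \<open>The only 0-tuple is \<open>[]\<close>, so these functionals are the
      coordinates of the single value \<open>f []\<close>; their common kernel is zero.\<close>
    let ?\<Lambda> = "(\<lambda>b. ({([], b)}, \<lambda>_. 1)) ` B"
    have "f [] = 0" if "\<And>b. b \<in> B \<Longrightarrow> coordinate ([], b) f = 0" for f
      using sum_representation[of "f []"] that by (simp add: coordinate_def)
    then have "coboundaries scl G \<pi> p = {f \<in> carrier (cochain_group G p).
        \<forall>(A, u)\<in>?\<Lambda>. (\<Sum>j\<in>A. u j * coordinate j f) = 0}"
      using 0 by (auto simp: cochain_group_def tuples_def coordinate_def representation_zero
          fun_eq_iff PiE_iff extensional_def)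
    then show ?thesis
      using 0 by (intro exI[of _ ?\<Lambda>]) (auto simp: tuples_def)
  next
    case (Suc q)
    \<comment> \<open>All finitely supported functionals that vanish on coboundaries are taken. One
      inclusion then holds by this choice, the other by
      \<open>coboundary_if_annihilated\<close>.\<close>
    let ?\<Lambda> = "{(A, u). finite A \<and> A \<subseteq> tuples G p \<times> B \<and>
        (\<forall>c. (\<Sum>j\<in>A. u j * coordinate j (coboundary scl G \<pi> p c)) = 0)}"
    have "coboundaries scl G \<pi> p = {f \<in> carrier (cochain_group G p).
        \<forall>(A, u)\<in>?\<Lambda>. (\<Sum>j\<in>A. u j * coordinate j f) = 0}"
    proof (intro equalityI subsetI)
      fix f assume "f \<in> coboundaries scl G \<pi> p"
      then show "f \<in> {f \<in> carrier (cochain_group G p).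
          \<forall>(A, u)\<in>?\<Lambda>. (\<Sum>j\<in>A. u j * coordinate j f) = 0}"
        using coboundaries_subset_cocycles[of p] Suc by (auto simp: cocycles_def)
    next
      fix f assume "f \<in> {f \<in> carrier (cochain_group G p).
          \<forall>(A, u)\<in>?\<Lambda>. (\<Sum>j\<in>A. u j * coordinate j f) = 0}"
      then show "f \<in> coboundaries scl G \<pi> p"
        unfolding Suc
      proof (intro coboundary_if_annihilated)
        fix A u
        assume "f \<in> {f \<in> carrier (cochain_group G (Suc q)).
            \<forall>(A, u)\<in>{(A, u). finite A \<and> A \<subseteq> tuples G (Suc q) \<times> B \<and>
              (\<forall>c. (\<Sum>j\<in>A. u j * coordinate j (coboundary scl G \<pi> (Suc q) c)) = 0)}.
              (\<Sum>j\<in>A. u j * coordinate j f) = 0}"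
          "finite A" "A \<subseteq> tuples G (Suc q) \<times> B"
          "\<And>c. (\<Sum>j\<in>A. u j * coordinate j (coboundary scl G \<pi> (Suc q) c)) = 0"
        then show "(\<Sum>j\<in>A. u j * coordinate j f) = 0" by simp
      qed simp
    qed
    then show ?thesis
      by (intro exI[of _ ?\<Lambda>]) auto
  qed
  then obtain \<Lambda> where \<Lambda>: "\<And>A u. (A, u) \<in> \<Lambda> \<Longrightarrow> finite A \<and> A \<subseteq> tuples G p \<times> B"
    and eq: "coboundaries scl G \<pi> p = {f \<in> carrier (cochain_group G p).
      \<forall>(A, u)\<in>\<Lambda>. (\<Sum>j\<in>A. u j * coordinate j f) = 0}"
    by blast
  have "closedin (cochain_topology G (vector_topology scl B) p) (coboundaries scl G \<pi> p)"
    unfolding eq coordinate_def by (rule closedin_common_kernel[OF \<Lambda>])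
  \<comment> \<open>A closed set of cochains contained in the cocycles is closed in the subspace
    topology as well.\<close>
  then have "closedin (cocycle_topology scl G \<pi> (vector_topology scl B) p) (coboundaries scl G \<pi> p)"
    unfolding cocycle_topology_def
    by (rule closedin_subset_topspace) (rule coboundaries_subset_cocycles)
  then show ?thesis using subgroup_coboundaries by blast
qed

end
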